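(* For every path $P\in\mathcal{P}_n$ that starts with $d$, the number $f(P)$ of chains from $P$ to $\mathbf{1}_n$ with small intervals and minimum length is equal to the number of increasing shifted tableaux $T$ of shape $\lambda(P)$ with $\max(T)=\delta(P)$.
   Context: A (binary) path of length $|P|=n$ is a word $P=p_1\cdots p_n$ in the letters $u$ (upstep $(1,1)$) and $d$ (downstep $(1,-1)$), viewed as a lattice path starting at the origin $(0,0)$. $\mathcal{P}_n$ is the set of paths of length $n$. $h_i(P)$ is the height ($y$-coordinate) of the $i$-th point of $P$ (after $i$ steps). $\mathcal{P}_n$ is partially ordered by $P\le Q$ iff $h_i(P)\le h_i(Q)$ for all $1\le i\le n$; this is a finite distributive lattice with maximum $\mathbf{1}_n=u^n$. A valley of $P$ is the last point of a maximal run of consecutive $d$'s: either the middle point of an occurrence of $du$, or the final point of $P$ if $P$ ends with $d$. Turning a valley into a peak means replacing the corresponding $du$ by $ud$, or replacing the final $d$ by $u$ if the valley is the final point. A $P-\mathbf{1}_n$ chain $P=P_0<P_1<\cdots<P_k=\mathbf{1}_n$ (of length $k$) has small intervals if for every $i\in\{1,\dots,k\}$ the path $P_i$ is obtained by (simultaneously) turning some valleys of $P_{i-1}$ into peaks. $f(P)$ is the number of $P-\mathbf{1}_n$ chains with small intervals whose length is minimum among all $P-\mathbf{1}_n$ chains with small intervals. The filling $\widetilde{P}$ of $P\ne\mathbf{1}_n$ is the path obtained by turning every valley of $P$ into a peak. Put $P^{(0)}=P$ and $P^{(i)}=\widetilde{P^{(i-1)}}$ as long as $P^{(i-1)}\ne\mathbf{1}_n$;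 the degree $\delta(P)$ is the number for which $P^{(\delta(P))}=\mathbf{1}_n$. (It is known that, for $P\neq\mathbf{1}_n$, $\delta(P)=|P|-1-\mathrm{lv}(P)$, where $\mathrm{lv}(P)$ is the height of the lowest valley of $P$, and that $\delta(P)$ is the length of every $P-\mathbf{1}_n$ chain with small intervals and minimum length.) Let $m=|P|_d$ be the number of $d$'s in $P$ and, for $1\le i\le m$, let $k_i$ be the number of $u$'s before the $i$-th $d$ of $P$. Then $\lambda(P)=(\lambda_1,\dots,\lambda_m)$ with $\lambda_i=n-i-k_i+1$; this is a strictly decreasing sequence of positive integers. The shifted diagram of shape $\lambda=(\lambda_1,\dots,\lambda_m)$ is the set of cells $\{(i,j):1\le i\le m,\ i\le j\le\lambda_i+i-1\}$. An increasing shifted tableau of shape $\lambda$ is a filling $T=(t_{i,j})$ of these cells with positive integers that is strictly increasing along rows (as $j$ increases) and along columns (as $i$ increases); $\max(T)$ is its maximum entry. *)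

theory Defs
  imports Main "HOL-Library.FuncSet"
begin

datatype step = U | D

type_synonym path = "step list"

definition paths :: "nat \<Rightarrow> path set" where
  "paths n = {P. length P = n}"

definition top_path :: "nat \<Rightarrow> path" where
  "top_path n = replicate n U"

definition height :: "path \<Rightarrow> nat \<Rightarrow> int" where
  "height P i = int (count_list (take i P) U) - int (count_list (take i P) D)"

definition path_le :: "path \<Rightarrow> path \<Rightarrow> bool" where
  "path_le P Q \<longleftrightarrow> length P = length Q \<and> (\<forall>i\<in>{1..length P}. height P i \<le> height Q i)"

definition path_less :: "path \<Rightarrow> path \<Rightarrow> bool" where
  "path_less P Q \<longleftrightarrow> path_le P Q \<and> P \<noteq> Q"

text \<open>A point of \<open>P\<close> is identified with the number \<open>i\<close> of steps leading to it. The step entering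
  it is therefore \<open>P ! (i - 1)\<close>, and the step leaving it, if \<open>i < length P\<close>, is \<open>P ! i\<close>.\<close>

definition valleys :: "path \<Rightarrow> nat set" where
  "valleys P = {i \<in> {1..length P}. P ! (i - 1) = D \<and> (i < length P \<longrightarrow> P ! i = U)}"

text \<open>For each \<open>i \<in> S\<close> the step entering point \<open>i\<close> becomes \<open>U\<close> and the step leaving it, if there
  is one, becomes \<open>D\<close>. Since \<open>i\<close> and \<open>i + 1\<close> are never both valleys, these replacements do not
  interfere when \<open>S \<subseteq> valleys P\<close>, which is the only intended use.\<close>

definition turn_valleys :: "nat set \<Rightarrow> path \<Rightarrow> path" where
  "turn_valleys S P =
     map (\<lambda>j. if Suc j \<in> S then U else if j \<in> S then D else P ! j) [0..<length P]"

text \<open>A chain \<open>P\<^sub>0 < \<dots> < P\<^sub>k\<close> is the list of its \<open>k + 1\<close> elements; its length is \<open>k\<close>.\<close>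

definition small_interval_chains :: "path \<Rightarrow> path list set" where
  "small_interval_chains P =
     {C. C \<noteq> [] \<and> hd C = P \<and> last C = top_path (length P) \<and>
         (\<forall>i. Suc i < length C \<longrightarrow>
            path_less (C ! i) (C ! Suc i) \<and>
            (\<exists>S \<subseteq> valleys (C ! i). C ! Suc i = turn_valleys S (C ! i)))}"

definition chain_length :: "path list \<Rightarrow> nat" where
  "chain_length C = length C - 1"

definition num_min_chains :: "path \<Rightarrow> nat" where
  "num_min_chains P =
     card {C \<in> small_interval_chains P.
            \<forall>C' \<in> small_interval_chains P. chain_length C \<le> chain_length C'}"

definition filling :: "path \<Rightarrow> path" where
  "filling P = turn_valleys (valleys P) P"

text \<open>The iteration stops when it first reaches the top path, hence the least such number.\<close>

definition degree :: "path \<Rightarrow> nat" where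
  "degree P = (LEAST k. (filling ^^ k) P = top_path (length P))"

definition num_downs :: "path \<Rightarrow> nat" where
  "num_downs P = count_list P D"

definition down_positions :: "path \<Rightarrow> nat list" where
  "down_positions P = filter (\<lambda>j. P ! j = D) [0..<length P]"

text \<open>The argument \<open>i\<close> counts the down-steps from 1.\<close>

definition ups_before :: "path \<Rightarrow> nat \<Rightarrow> nat" where
  "ups_before P i = count_list (take (down_positions P ! (i - 1)) P) U"

text \<open>Entry number \<open>i\<close> (from 1) is \<open>n - i - k\<^sub>i + 1\<close>, where \<open>k\<^sub>i = ups_before P i\<close>. The prefix of
  \<open>P\<close> ending with the \<open>i\<close>-th down-step has length \<open>i + k\<^sub>i \<le> n\<close>, so the subtraction is exact.\<close>

definition path_shape :: "path \<Rightarrow> nat list" where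
  "path_shape P = map (\<lambda>i. length P + 1 - (i + ups_before P i)) [1..<num_downs P + 1]"

definition shifted_diagram :: "nat list \<Rightarrow> (nat \<times> nat) set" where
  "shifted_diagram lam =
     {(i, j). 1 \<le> i \<and> i \<le> length lam \<and> i \<le> j \<and> j \<le> lam ! (i - 1) + i - 1}"

text \<open>Tableaux are extensional functions, so that each filling of the diagram is counted once.\<close>

definition increasing_shifted_tableaux :: "nat list \<Rightarrow> (nat \<times> nat \<Rightarrow> nat) set" where
  "increasing_shifted_tableaux lam =
     {T \<in> shifted_diagram lam \<rightarrow>\<^sub>E {1..}.
        (\<forall>i j j'. (i, j) \<in> shifted_diagram lam \<and> (i, j') \<in> shifted_diagram lam \<and> j < j'
           \<longrightarrow> T (i, j) < T (i, j')) \<and>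
        (\<forall>i i' j. (i, j) \<in> shifted_diagram lam \<and> (i', j) \<in> shifted_diagram lam \<and> i < i'
           \<longrightarrow> T (i, j) < T (i', j))}"

definition max_entry :: "nat list \<Rightarrow> (nat \<times> nat \<Rightarrow> nat) \<Rightarrow> nat" where
  "max_entry lam T = Max (T ` shifted_diagram lam)"

end

theory Submission
  imports Defs
begin

text \<open>
  A path \<open>Q\<close> of length \<open>n\<close> is determined by the numbers \<open>downs Q t\<close> of downsteps among its first
  \<open>t\<close> steps. In these terms the cell \<open>(i, j)\<close>, with \<open>1 \<le> i \<le> j\<close>, belongs to the shifted diagram of
  \<open>Q\<close> if and only if \<open>i \<le> downs Q (n + i - j)\<close>: the \<open>t\<close>-th point of the path governs the diagonal
  \<open>j - i = n - t\<close>, and \<open>downs Q t\<close> is the number of cells on it. So paths are the same thing as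
  those sets of cells that are closed under moving left and up.

  Turning a valley at point \<open>t\<close> changes \<open>downs\<close> only at \<open>t\<close>, where it drops by 1, so it removes a
  corner from the diagram. Hence \<open>Q'\<close> arises from \<open>Q\<close> by turning valleys exactly when its diagram
  lies between \<open>inner (diagram Q)\<close>, the cells of \<open>Q\<close> that have another cell to the right or below,
  and \<open>diagram Q\<close> (\<open>small_step_iff\<close>); the filling realises the lower bound.

  Call \<open>P = C\<^sub>0, \<dots>, C\<^sub>k = 1\<^sub>n\<close> a weak chain if each path arises from the preceding one by turning a
  possibly empty set of valleys. Let \<open>T c \<le> s\<close> mean that the cell \<open>c\<close> is still present in
  \<open>C\<^sub>k\<^sub>-\<^sub>s\<close>. The condition that every cell with a right or lower neighbour in one diagram survives in
  the next says exactly that \<open>T\<close> is strictly increasing along rows and columns. This yields, for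
  every \<open>k\<close>, a bijection between the weak chains of length \<open>k\<close> and the tableaux with entries at most
  \<open>k\<close> (\<open>bij_betw_tableau_of\<close>).

  It remains to see that the two minimality conditions match when \<open>k\<close> is the degree. Since filling is
  monotone and removes as much as possible, the \<open>s\<close>-th member of a weak chain contains the \<open>s\<close>-th
  iterated filling of \<open>P\<close>. Thus no weak chain is shorter than the degree, and one of this length
  cannot stand still, because it would then reach the top a step behind the fillings. So the weak
  chains of length \<open>degree P\<close> are the minimal chains with small intervals. On the other side, no tableau has
  all entries below the degree, since it would come from a weak chain that is too short;
  so entries at most \<open>degree P\<close> means maximum equal to \<open>degree P\<close>.
\<close>

section \<open>Counting downsteps\<close>

definition downs :: "path \<Rightarrow> nat \<Rightarrow> nat" where
  "downs Q t = count_list (take t Q) D"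

lemma downs_0 [simp]: "downs Q 0 = 0"
  by (simp add: downs_def)

lemma downs_Suc:
  assumes "t < length Q"
  shows "downs Q (Suc t) = downs Q t + (if Q ! t = D then 1 else 0)"
  using assms by (simp add: downs_def take_Suc_conv_app_nth)

lemma downs_add_bounds:
  assumes "t + m \<le> length Q"
  shows "downs Q t \<le> downs Q (t + m) \<and> downs Q (t + m) \<le> downs Q t + m"
  using assms by (induction m) (auto simp: downs_Suc)

lemma downs_mono:
  assumes "t \<le> t'" and "t' \<le> length Q"
  shows "downs Q t \<le> downs Q t'"
  using downs_add_bounds[of t "t' - t" Q] assms by simp

lemma downs_le_add:
  assumes "t \<le> t'" and "t' \<le> length Q"
  shows "downs Q t' \<le> downs Q t + (t' - t)"
  using downs_add_bounds[of t "t' - t" Q] assms by simp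

lemma downs_le: "t \<le> length Q \<Longrightarrow> downs Q t \<le> t"
  using downs_le_add[of 0 t Q] by simp

lemma step_neq_D_iff: "x \<noteq> D \<longleftrightarrow> x = U"
  by (cases x) auto

lemma path_eqI_downs:
  assumes len: "length Q = length Q'"
    and eq: "\<And>t. t \<le> length Q \<Longrightarrow> downs Q t = downs Q' t"
  shows "Q = Q'"
proof (rule nth_equalityI[OF len])
  fix t assume t: "t < length Q"
  have "(if Q ! t = D then 1 else 0) = (if Q' ! t = D then 1 else (0::nat))"
    using downs_Suc[OF t] downs_Suc[of t Q'] eq[of t] eq[of "Suc t"] t len by simp
  then show "Q ! t = Q' ! t"
    by (cases "Q ! t"; cases "Q' ! t") auto
qed

text \<open>Together with \<open>path_eqI_downs\<close>, this identifies the paths of length \<open>n\<close> with the functions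
  on \<open>{0..n}\<close> that start at 0 and have increments 0 or 1.\<close>

lemma path_with_downs:
  assumes g0: "g 0 = 0"
    and up: "\<And>t. t < n \<Longrightarrow> g t \<le> g (Suc t)"
    and by1: "\<And>t. t < n \<Longrightarrow> g (Suc t) \<le> g t + 1"
  obtains Q where "length Q = n" and "\<And>t. t \<le> n \<Longrightarrow> downs Q t = g t"
proof -
  define Q where "Q = map (\<lambda>t. if g (Suc t) = g t then U else D) [0..<n]"
  have len: "length Q = n" by (simp add: Q_def)
  have "downs Q t = g t" if "t \<le> n" for t
    using that
  proof (induction t)
    case 0
    then show ?case by (simp add: g0)
  next
    case (Suc t)
    then show ?case
      using up[of t] by1[of t] by (auto simp: downs_Suc len Q_def)
  qed
  with len show thesis by (rule that)
qed

lemma count_U_plus_downs: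
  "t \<le> length Q \<Longrightarrow> count_list (take t Q) U + downs Q t = t"
proof (induction t)
  case (Suc t)
  then show ?case
    by (cases "Q ! t") (simp_all add: downs_def take_Suc_conv_app_nth)
qed simp

lemma height_eq_downs:
  assumes "t \<le> length Q"
  shows "height Q t = int t - 2 * int (downs Q t)"
  using count_U_plus_downs[OF assms] by (simp add: height_def downs_def)

lemma downs_top: "downs (top_path n) t = 0"
  by (simp add: downs_def top_path_def count_list_0_iff)

lemma length_turn_valleys [simp]: "length (turn_valleys S Q) = length Q"
  by (simp add: turn_valleys_def)

lemma steps_at_valleys:
  assumes "S \<subseteq> valleys Q" and "t < length Q"
  shows "Suc t \<in> S \<Longrightarrow> Q ! t = D" and "t \<in> S \<Longrightarrow> Q ! t = U"
  using subsetD[OF assms(1), of "Suc t"] subsetD[OF assms(1), of t] assms(2)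
  by (auto simp: valleys_def)

text \<open>At a valley \<open>t\<close> a downstep moves from position \<open>t\<close> to \<open>t + 1\<close>, or off the end of the path if
  \<open>t\<close> is the final point. All prefixes except the one of length \<open>t\<close> keep their number of downsteps.\<close>

lemma downs_turn_valleys:
  assumes S: "S \<subseteq> valleys Q" and "t \<le> length Q"
  shows "downs (turn_valleys S Q) t + (if t \<in> S then 1 else 0) = downs Q t"
  using assms(2)
proof (induction t)
  case 0
  have "0 \<notin> S" using S by (auto simp: valleys_def)
  then show ?case by simp
next
  case (Suc t)
  have t: "t < length Q" using Suc.prems by simp
  show ?case
    using Suc t steps_at_valleys[OF S t] by (auto simp: downs_Suc turn_valleys_def split: if_splits)
qed

section \<open>The diagram of a path\<close>

text \<open>For \<open>j \<ge> length Q + i\<close> the truncated subtraction gives 0, and \<open>downs Q 0 = 0 < i\<close> excludes the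
  cell, as it should.\<close>

definition diagram :: "path \<Rightarrow> (nat \<times> nat) set" where
  "diagram Q = {(i, j). 1 \<le> i \<and> i \<le> j \<and> i \<le> downs Q (length Q + i - j)}"

lemma down_positions_split:
  assumes "t \<le> length Q"
  shows "down_positions Q =
    filter (\<lambda>j. Q ! j = D) [0..<t] @ filter (\<lambda>j. Q ! j = D) [t..<length Q]"
  using upt_add_eq_append[of 0 t "length Q - t"] assms
  by (simp add: down_positions_def)

lemma downs_eq_length_filter:
  "t \<le> length Q \<Longrightarrow> downs Q t = length (filter (\<lambda>j. Q ! j = D) [0..<t])"
  by (induction t) (auto simp: downs_Suc)

lemma num_downs_eq: "num_downs Q = downs Q (length Q)"
  by (simp add: num_downs_def downs_def)

lemma length_down_positions: "length (down_positions Q) = num_downs Q"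
  by (simp add: num_downs_eq downs_eq_length_filter down_positions_def)

lemma nth_down_position_less_iff:
  assumes "i < num_downs Q" and t: "t \<le> length Q"
  shows "down_positions Q ! i < t \<longleftrightarrow> i < downs Q t"
proof -
  let ?A = "filter (\<lambda>j. Q ! j = D) [0..<t]"
  let ?B = "filter (\<lambda>j. Q ! j = D) [t..<length Q]"
  have i: "i < length (?A @ ?B)"
    using assms(1) down_positions_split[OF t] by (metis length_down_positions)
  show ?thesis
  proof (cases "i < length ?A")
    case True
    then have "?A ! i \<in> set ?A" by (rule nth_mem)
    then have "?A ! i < t" by auto
    with True show ?thesis
      by (simp add: down_positions_split[OF t] downs_eq_length_filter[OF t] nth_append)
  next
    case False
    with i have "?B ! (i - length ?A) \<in> set ?B" by (intro nth_mem) auto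
    then have "t \<le> ?B ! (i - length ?A)" by auto
    with False show ?thesis
      by (simp add: down_positions_split[OF t] downs_eq_length_filter[OF t] nth_append)
  qed
qed

lemma path_shape_nth:
  assumes i: "1 \<le> i" "i \<le> num_downs Q"
  shows "path_shape Q ! (i - 1) = length Q - down_positions Q ! (i - 1)"
    and "down_positions Q ! (i - 1) < length Q"
proof -
  let ?p = "down_positions Q ! (i - 1)"
  have i': "i - 1 < num_downs Q" using i by linarith
  show p: "?p < length Q"
    using nth_down_position_less_iff[OF i', of "length Q"] i' by (simp add: num_downs_eq)
  have "downs Q ?p \<le> i - 1"
    using nth_down_position_less_iff[OF i', of ?p] p by simp
  moreover have "i - 1 < downs Q (Suc ?p)"
    using nth_down_position_less_iff[OF i', of "Suc ?p"] p by simp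
  ultimately have "downs Q ?p = i - 1"
    using downs_Suc[OF p] by (simp split: if_splits)
  then have "i + ups_before Q i = ?p + 1"
    using count_U_plus_downs[of ?p Q] p i by (simp add: ups_before_def)
  moreover have "path_shape Q ! (i - 1) = length Q + 1 - (i + ups_before Q i)"
    using i unfolding path_shape_def by (subst nth_map) (auto simp del: upt_Suc)
  ultimately show "path_shape Q ! (i - 1) = length Q - ?p" by simp
qed

text \<open>If \<open>p\<close> is the index, from 0, of the \<open>i\<close>-th downstep, then the \<open>i\<close>-th part is \<open>n - p\<close>. So row
  \<open>i\<close> consists of the \<open>j \<ge> i\<close> with \<open>j < n - p + i\<close>, that is, \<open>p < n + i - j\<close>, which says that
  the first \<open>n + i - j\<close> steps contain at least \<open>i\<close> downsteps.\<close>

lemma shifted_diagram_path_shape: "shifted_diagram (path_shape Q) = diagram Q"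
proof -
  have len: "length (path_shape Q) = num_downs Q" by (simp add: path_shape_def)
  have "(i, j) \<in> shifted_diagram (path_shape Q) \<longleftrightarrow> (i, j) \<in> diagram Q" for i j
  proof (cases "1 \<le> i \<and> i \<le> j")
    case False
    then show ?thesis by (auto simp: shifted_diagram_def diagram_def)
  next
    case ij: True
    show ?thesis
    proof (cases "i \<le> num_downs Q")
      case True
      have i': "i - 1 < num_downs Q" using ij True by linarith
      have "i \<le> downs Q (length Q + i - j)
          \<longleftrightarrow> down_positions Q ! (i - 1) < length Q + i - j"
        using nth_down_position_less_iff[OF i', of "length Q + i - j"] ij by linarith
      then show ?thesis
        using ij True path_shape_nth[of i Q] len
        by (auto simp: shifted_diagram_def diagram_def)
    next
      case False
      moreover have "downs Q (length Q + i - j) \<le> num_downs Q"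
        unfolding num_downs_eq using ij by (intro downs_mono) auto
      ultimately show ?thesis
        using len by (auto simp: shifted_diagram_def diagram_def)
    qed
  qed
  then show ?thesis by auto
qed

lemma le_downs_iff_diagram:
  assumes "t \<le> length Q" "1 \<le> i"
  shows "i \<le> downs Q t \<longleftrightarrow> (i, length Q + i - t) \<in> diagram Q"
  using assms by (auto simp: diagram_def)

lemma diagram_subset_iff:
  assumes "length Q = length Q'"
  shows "diagram Q \<subseteq> diagram Q' \<longleftrightarrow> (\<forall>t \<le> length Q. downs Q t \<le> downs Q' t)"
proof
  assume sub: "diagram Q \<subseteq> diagram Q'"
  show "\<forall>t \<le> length Q. downs Q t \<le> downs Q' t"
  proof (intro allI impI)
    fix t assume t: "t \<le> length Q"
    show "downs Q t \<le> downs Q' t"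
    proof (cases "downs Q t = 0")
      case False
      then show ?thesis
        using le_downs_iff_diagram[of t Q "downs Q t"]
          le_downs_iff_diagram[of t Q' "downs Q t"] t sub assms by auto
    qed simp
  qed
next
  assume le: "\<forall>t \<le> length Q. downs Q t \<le> downs Q' t"
  show "diagram Q \<subseteq> diagram Q'"
  proof clarify
    fix i j assume "(i, j) \<in> diagram Q"
    then have "1 \<le> i" "i \<le> j" "i \<le> downs Q (length Q + i - j)" by (auto simp: diagram_def)
    moreover from this have "downs Q (length Q + i - j) \<le> downs Q' (length Q + i - j)"
      using le by auto
    ultimately show "(i, j) \<in> diagram Q'" using assms by (auto simp: diagram_def)
  qed
qed

lemma diagram_inj:
  assumes "length Q = length Q'" and "diagram Q = diagram Q'"
  shows "Q = Q'"
  using assms diagram_subset_iff[of Q Q'] diagram_subset_iff[of Q' Q]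
  by (intro path_eqI_downs) (auto intro!: antisym)

lemma diagram_top [simp]: "diagram (top_path n) = {}"
  by (auto simp: diagram_def downs_top)

lemma length_top [simp]: "length (top_path n) = n"
  by (simp add: top_path_def)

lemma finite_diagram: "finite (diagram Q)"
proof (rule finite_subset)
  show "diagram Q \<subseteq> {..length Q} \<times> {..2 * length Q}"
  proof clarify
    fix i j assume "(i, j) \<in> diagram Q"
    then have ij: "1 \<le> i" "i \<le> j" "i \<le> downs Q (length Q + i - j)" by (auto simp: diagram_def)
    then have "i \<le> length Q + i - j"
      using downs_le[of "length Q + i - j" Q] by linarith
    then show "i \<in> {..length Q} \<and> j \<in> {..2 * length Q}" using ij by auto
  qed
qed simp

section \<open>Turning valleys means removing corners\<close>

definition before :: "nat \<times> nat \<Rightarrow> nat \<times> nat \<Rightarrow> bool" where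
  "before c c' \<longleftrightarrow>
     fst c = fst c' \<and> snd c < snd c' \<or> snd c = snd c' \<and> fst c < fst c'"

text \<open>For a set closed under moving left and up, these are its cells that are not corners; such
  closedness itself is expressed by \<open>inner A \<subseteq> A\<close>.\<close>

definition inner :: "(nat \<times> nat) set \<Rightarrow> (nat \<times> nat) set" where
  "inner A = {c. 1 \<le> fst c \<and> fst c \<le> snd c \<and> (\<exists>c' \<in> A. before c c')}"

lemma inner_mono: "A \<subseteq> B \<Longrightarrow> inner A \<subseteq> inner B"
  unfolding inner_def by blast

text \<open>Passing from a cell to its left neighbour leads from the diagonal of point \<open>t\<close> to that of
  \<open>t + 1\<close> within the same row; passing to the upper neighbour leads from \<open>t + 1\<close> to \<open>t\<close> and one row
  up. These two moves give the two inequalities. Longer moves along a row or a column reduce to them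
  because \<open>downs\<close> has increments 0 and 1.\<close>

lemma inner_diagram_subset_iff:
  assumes len: "length Q' = length Q"
  shows "inner (diagram Q) \<subseteq> diagram Q' \<longleftrightarrow>
    (\<forall>t < length Q. downs Q t \<le> downs Q' (Suc t) \<and> downs Q (Suc t) \<le> downs Q' t + 1)"
    (is "?L \<longleftrightarrow> ?R")
proof
  assume L: ?L
  show ?R
  proof (intro allI impI conjI)
    fix t assume t: "t < length Q"
    show "downs Q t \<le> downs Q' (Suc t)"
    proof (cases "downs Q t = 0")
      case False
      let ?i = "downs Q t"
      have "(?i, length Q + ?i - t) \<in> diagram Q"
        using le_downs_iff_diagram[of t Q ?i] False t by simp
      then have "(?i, length Q + ?i - Suc t) \<in> inner (diagram Q)"
        using False t unfolding inner_def before_def by force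
      then show ?thesis
        using le_downs_iff_diagram[of "Suc t" Q' ?i] False t L len by auto
    qed simp
    show "downs Q (Suc t) \<le> downs Q' t + 1"
    proof (cases "downs Q (Suc t) \<le> 1")
      case False
      let ?i = "downs Q (Suc t) - 1"
      have "(Suc ?i, length Q + Suc ?i - Suc t) \<in> diagram Q"
        using le_downs_iff_diagram[of "Suc t" Q "Suc ?i"] False t by simp
      then have "(?i, length Q + ?i - t) \<in> inner (diagram Q)"
        using False t unfolding inner_def before_def by force
      then have "?i \<le> downs Q' t"
        using le_downs_iff_diagram[of t Q' ?i] False t L len by auto
      then show ?thesis by simp
    qed simp
  qed
next
  assume R: ?R
  show ?L
  proof clarify
    fix i j assume "(i, j) \<in> inner (diagram Q)"
    then obtain i' j' where ij: "1 \<le> i" "i \<le> j" and c': "(i', j') \<in> diagram Q"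
      and bef: "i = i' \<and> j < j' \<or> j = j' \<and> i < i'"
      by (auto simp: inner_def before_def)
    let ?n = "length Q"
    let ?x = "?n + i - j" and ?y = "?n + i' - j'"
    have y: "i' \<le> downs Q ?y" "i' \<le> j'" "?y \<le> ?n" using c' by (auto simp: diagram_def)
    then have y_ge: "i' \<le> ?y" using downs_le[of ?y Q] by simp
    from bef have "i \<le> downs Q' ?x"
    proof
      assume row: "i = i' \<and> j < j'"
      then have "?y < ?n" "Suc ?y \<le> ?x" "?x \<le> ?n" using y_ge ij by auto
      then have "downs Q ?y \<le> downs Q' (Suc ?y)" "downs Q' (Suc ?y) \<le> downs Q' ?x"
        using R len by (auto intro: downs_mono)
      with row y show ?thesis by simp
    next
      assume col: "j = j' \<and> i < i'"
      then have x: "Suc ?x \<le> ?y" "?y - Suc ?x = i' - Suc i" "?x < ?n" using y_ge y ij by auto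
      then have "downs Q ?y \<le> downs Q (Suc ?x) + (i' - Suc i)"
        using downs_le_add[of "Suc ?x" ?y Q] y by simp
      moreover have "downs Q (Suc ?x) \<le> downs Q' ?x + 1" using R x by simp
      moreover have "i \<le> c" if "a \<le> b + (i' - Suc i)" "b \<le> c + 1" "i' \<le> a" for a b c
        using that col by linarith
      ultimately show ?thesis using y(1) by blast
    qed
    then show "(i, j) \<in> diagram Q'" using ij len by (simp add: diagram_def)
  qed
qed

lemma inner_diagram_subset: "inner (diagram Q) \<subseteq> diagram Q"
  by (subst inner_diagram_subset_iff) (auto simp: downs_Suc)

definition small_step :: "path \<Rightarrow> path \<Rightarrow> bool" where
  "small_step Q Q' \<longleftrightarrow> (\<exists>S \<subseteq> valleys Q. Q' = turn_valleys S Q)"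

text \<open>For the converse direction, let \<open>S\<close> be the set of points at which the two paths differ. If
  \<open>t \<in> S\<close>, then \<open>downs Q (t - 1) \<le> downs Q' t < downs Q t\<close> forces the step of \<open>Q\<close> into \<open>t\<close> to go
  down, and \<open>downs Q (t + 1) \<le> downs Q' t + 1 \<le> downs Q t\<close> forces the next one to go up, so \<open>t\<close> is
  a valley of \<open>Q\<close>.\<close>

lemma small_step_iff:
  "small_step Q Q' \<longleftrightarrow>
     length Q' = length Q \<and> inner (diagram Q) \<subseteq> diagram Q' \<and> diagram Q' \<subseteq> diagram Q"
    (is "_ \<longleftrightarrow> ?R")
proof
  assume "small_step Q Q'"
  then obtain S where S: "S \<subseteq> valleys Q" and Q': "Q' = turn_valleys S Q"
    by (auto simp: small_step_def)
  have dn: "downs Q' t + (if t \<in> S then 1 else 0) = downs Q t" if "t \<le> length Q" for t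
    using downs_turn_valleys[OF S that] Q' by simp
  have "downs Q t \<le> downs Q' (Suc t) \<and> downs Q (Suc t) \<le> downs Q' t + 1" if t: "t < length Q" for t
    using dn[of t] dn[of "Suc t"] downs_Suc[OF t] t steps_at_valleys[OF S t]
    by (auto split: if_splits)
  then have "inner (diagram Q) \<subseteq> diagram Q'"
    using Q' by (simp add: inner_diagram_subset_iff)
  moreover have "diagram Q' \<subseteq> diagram Q"
    using dn Q' by (subst diagram_subset_iff) (auto simp: le_iff_add, metis)
  ultimately show ?R using Q' by simp
next
  assume R: ?R
  then have len: "length Q' = length Q" by simp
  have le: "downs Q' t \<le> downs Q t" if "t \<le> length Q" for t
    using R diagram_subset_iff[of Q' Q] that by simp
  have nb: "downs Q t \<le> downs Q' (Suc t)" "downs Q (Suc t) \<le> downs Q' t + 1"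
    if "t < length Q" for t
    using R inner_diagram_subset_iff[OF len] that by auto
  define S where "S = {t. t \<le> length Q \<and> downs Q' t < downs Q t}"
  have S: "S \<subseteq> valleys Q"
  proof
    fix t assume "t \<in> S"
    then have t: "t \<le> length Q" "downs Q' t < downs Q t" by (auto simp: S_def)
    then obtain t0 where t0: "t = Suc t0" by (cases t) auto
    have "Q ! t0 = D"
      using nb(1)[of t0] t t0 downs_Suc[of t0 Q] by (auto split: if_splits)
    moreover have "Q ! t = U" if "t < length Q"
      using nb(2)[OF that] t downs_Suc[OF that] step_neq_D_iff[of "Q ! t"]
      by (auto split: if_splits)
    ultimately show "t \<in> valleys Q" using t t0 by (auto simp: valleys_def)
  qed
  have "Q' = turn_valleys S Q"
  proof (rule path_eqI_downs)
    fix t assume "t \<le> length Q'"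
    then have t: "t \<le> length Q" using len by simp
    show "downs Q' t = downs (turn_valleys S Q) t"
    proof (cases "t \<in> S")
      case True
      then obtain t0 where t0: "t = Suc t0" using S by (cases t) (auto simp: valleys_def)
      have "downs Q t \<le> downs Q' t + 1"
        using nb(1)[of t0] downs_Suc[of t0 Q] t t0 by (auto split: if_splits)
      with True show ?thesis using downs_turn_valleys[OF S t] by (simp add: S_def)
    next
      case False
      then show ?thesis using downs_turn_valleys[OF S t] le[OF t] t by (simp add: S_def)
    qed
  qed (simp add: len)
  with S show "small_step Q Q'" by (auto simp: small_step_def)
qed

text \<open>The number of cells of \<open>A\<close> on each diagonal determines the path. Closedness under moving left and
  up makes every diagonal an initial segment, and makes these numbers grow by 0 or 1 from one
  diagonal to the next.\<close>

lemma closed_set_is_diagram: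
  assumes A: "A \<subseteq> diagram P" and closed: "inner A \<subseteq> A"
  obtains Q where "length Q = length P" and "diagram Q = A"
proof -
  let ?n = "length P"
  define B where "B t = {i. 1 \<le> i \<and> (i, ?n + i - t) \<in> A}" for t
  define g where "g t = card (B t)" for t
  have fin: "finite (B t)" for t
  proof (rule finite_subset)
    show "B t \<subseteq> fst ` diagram P" using A by (force simp: B_def)
  qed (simp add: finite_diagram)
  have left: "(i, j) \<in> A" if "(i, j') \<in> A" "1 \<le> i" "i \<le> j" "j < j'" for i j j'
    using that by (intro subsetD[OF closed])
      (auto simp: inner_def before_def intro!: bexI[of _ "(i, j')"])
  have above: "(i, j) \<in> A" if "(i', j) \<in> A" "1 \<le> i" "i < i'" for i i' j
  proof -
    have "i' \<le> j" using that A by (auto simp: diagram_def)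
    then show ?thesis
      using that by (intro subsetD[OF closed])
        (auto simp: inner_def before_def intro!: bexI[of _ "(i', j)"])
  qed
  have down: "i \<in> B t" if "i' \<in> B t" "1 \<le> i" "i < i'" "t \<le> ?n" for i i' t
  proof -
    have "(i, ?n + i' - t) \<in> A" using that above[of i'] by (simp add: B_def)
    then have "(i, ?n + i - t) \<in> A" by (rule left) (use that in auto)
    with that show ?thesis by (simp add: B_def)
  qed
  have B_eq: "B t = {1..g t}" if t: "t \<le> ?n" for t
  proof (cases "B t = {}")
    case True
    then show ?thesis by (simp add: g_def)
  next
    case False
    have "B t = {1..Max (B t)}"
    proof
      show "B t \<subseteq> {1..Max (B t)}" using fin[of t] by (auto simp: B_def)
      show "{1..Max (B t)} \<subseteq> B t"
        using Max_in[OF fin False] down[OF Max_in[OF fin False] _ _ t]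
        by (metis atLeastAtMost_iff le_neq_implies_less subsetI)
    qed
    then show ?thesis unfolding g_def by (metis card_atLeastAtMost diff_Suc_1 One_nat_def)
  qed
  have g_iff: "i \<le> g t \<longleftrightarrow> (i, ?n + i - t) \<in> A" if "t \<le> ?n" "1 \<le> i" for i t
  proof -
    have "i \<le> g t \<longleftrightarrow> i \<in> B t" using B_eq[OF that(1)] that(2) by simp
    then show ?thesis using that(2) by (simp add: B_def)
  qed
  have g0: "g 0 = 0"
    using g_iff[of 0 "g 0"] A by (cases "g 0 = 0") (auto simp: diagram_def)
  have up: "g t \<le> g (Suc t)" if "t < ?n" for t
  proof (cases "g t = 0")
    case False
    then have "(g t, ?n + g t - t) \<in> A" using g_iff[of t "g t"] that by simp
    then have "(g t, ?n + g t - Suc t) \<in> A" by (rule left) (use that False in auto)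
    then show ?thesis using g_iff[of "Suc t" "g t"] that False by simp
  qed simp
  have by1: "g (Suc t) \<le> g t + 1" if "t < ?n" for t
  proof (cases "g (Suc t) \<le> 1")
    case False
    let ?i = "g (Suc t) - 1"
    have "(Suc ?i, ?n + Suc ?i - Suc t) \<in> A" using g_iff[of "Suc t" "Suc ?i"] that False by simp
    then have "(?i, ?n + ?i - t) \<in> A" using above[of "Suc ?i" _ ?i] False by simp
    moreover have "1 \<le> ?i" using False by linarith
    ultimately have "?i \<le> g t" using g_iff[of t ?i] that by simp
    then show ?thesis by linarith
  qed simp
  obtain Q where Q: "length Q = ?n" "\<And>t. t \<le> ?n \<Longrightarrow> downs Q t = g t"
    using path_with_downs[of g ?n, OF g0 up by1] by metis
  have "(i, j) \<in> diagram Q \<longleftrightarrow> (i, j) \<in> A" for i j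
  proof (cases "1 \<le> i \<and> i \<le> j")
    case False
    then show ?thesis using A by (auto simp: diagram_def)
  next
    case ij: True
    show ?thesis
    proof (cases "j \<le> ?n + i")
      case True
      have "?n + i - j \<le> ?n" using ij by linarith
      then show ?thesis
        using ij Q True g_iff[of "?n + i - j" i] by (simp add: diagram_def)
    next
      case False
      then have "(i, j) \<notin> diagram P" "(i, j) \<notin> diagram Q"
        using Q(1) by (simp_all add: diagram_def)
      then show ?thesis using A by blast
    qed
  qed
  then have "diagram Q = A" by auto
  with Q(1) show thesis by (rule that)
qed

section \<open>Fillings\<close>

lemma small_step_filling: "small_step Q (filling Q)"
  by (auto simp: small_step_def filling_def)

lemma length_filling [simp]: "length (filling Q) = length Q"
  by (simp add: filling_def)

text \<open>The set on the right is the diagram of some path, which arises from \<open>Q\<close> by turning valleys; and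
  turning all valleys removes at least as much as turning some of them.\<close>

lemma diagram_filling: "diagram (filling Q) = inner (diagram Q)"
proof
  show "inner (diagram Q) \<subseteq> diagram (filling Q)"
    using small_step_filling by (simp add: small_step_iff)
  obtain R where R: "length R = length Q" "diagram R = inner (diagram Q)"
    using closed_set_is_diagram[of "inner (diagram Q)" Q] inner_diagram_subset inner_mono
    by blast
  then have "small_step Q R"
    using inner_diagram_subset by (simp add: small_step_iff)
  then obtain S where S: "S \<subseteq> valleys Q" "R = turn_valleys S Q"
    by (auto simp: small_step_def)
  have "downs (filling Q) t \<le> downs R t" if "t \<le> length Q" for t
    using downs_turn_valleys[OF S(1) that] downs_turn_valleys[OF subset_refl that] S
    by (auto simp: filling_def split: if_splits)
  then show "diagram (filling Q) \<subseteq> inner (diagram Q)"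
    using diagram_subset_iff[of "filling Q" R] R by simp
qed

lemma length_filling_iter [simp]: "length ((filling ^^ m) Q) = length Q"
  by (induction m) auto

section \<open>Weak chains and tableaux\<close>

text \<open>Repetitions are allowed because tableaux with entries at most \<open>k\<close> need not use every value
  in \<open>{1..k}\<close>: a missing value corresponds to a step that stands still.\<close>

definition weak_chains :: "path \<Rightarrow> nat \<Rightarrow> path list set" where
  "weak_chains P k = {C. length C = Suc k \<and> C ! 0 = P \<and> C ! k = top_path (length P) \<and>
     (\<forall>i < k. small_step (C ! i) (C ! Suc i))}"

lemma weak_chain_length:
  assumes "C \<in> weak_chains P k" "s \<le> k"
  shows "length (C ! s) = length P"
  using assms(2)
proof (induction s)
  case 0
  then show ?case using assms(1) by (simp add: weak_chains_def)
next
  case (Suc s)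
  then show ?case using assms(1) by (simp add: weak_chains_def small_step_iff)
qed

lemma weak_chain_antimono:
  assumes "C \<in> weak_chains P k" "s \<le> s'" "s' \<le> k"
  shows "diagram (C ! s') \<subseteq> diagram (C ! s)"
  using assms(2,3)
proof (induction s' rule: dec_induct)
  case (step m)
  then have "diagram (C ! Suc m) \<subseteq> diagram (C ! m)"
    using assms(1) by (simp add: weak_chains_def small_step_iff)
  with step show ?case by auto
qed simp

text \<open>By monotonicity of \<open>inner\<close>, if a path dominates a member of the chain, then its fillings
  keep dominating the later members. The comparison may start at any index \<open>a\<close>, which is what
  excludes repetitions in \<open>weak_chain_degree_strict\<close>.\<close>

lemma filling_iter_le_weak_chain:
  assumes "C \<in> weak_chains P k" "diagram R \<subseteq> diagram (C ! a)" "a + m \<le> k"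
  shows "diagram ((filling ^^ m) R) \<subseteq> diagram (C ! (a + m))"
  using assms(3)
proof (induction m)
  case 0
  then show ?case using assms(2) by simp
next
  case (Suc m)
  then have "inner (diagram ((filling ^^ m) R)) \<subseteq> inner (diagram (C ! (a + m)))"
    by (intro inner_mono) simp
  also have "\<dots> \<subseteq> diagram (C ! (a + Suc m))"
    using assms(1) Suc.prems by (simp add: weak_chains_def small_step_iff)
  finally show ?case by (simp add: diagram_filling)
qed

lemma degree_le:
  assumes "diagram ((filling ^^ k) P) = {}"
  shows "degree P \<le> k"
  unfolding degree_def
  by (intro Least_le diagram_inj) (use assms in simp_all)

lemma degree_le_weak_chain:
  assumes C: "C \<in> weak_chains P k"
  shows "degree P \<le> k"
proof (rule degree_le)
  have "diagram P \<subseteq> diagram (C ! 0)" "diagram (C ! k) = {}"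
    using C by (auto simp: weak_chains_def)
  then show "diagram ((filling ^^ k) P) = {}"
    using filling_iter_le_weak_chain[OF C, of P 0 k] by simp
qed

text \<open>If the chain stood still at step \<open>i\<close>, its member number \<open>i + 1\<close> would already contain the
  \<open>i\<close>-th iterated filling, and from there on the fillings would stay one step ahead of the chain and
  reach the top before \<open>degree P\<close>.\<close>

lemma weak_chain_degree_strict:
  assumes C: "C \<in> weak_chains P (degree P)" and i: "i < degree P"
  shows "C ! i \<noteq> C ! Suc i"
proof
  assume eq: "C ! i = C ! Suc i"
  let ?k = "degree P" and ?R = "(filling ^^ i) P"
  have "diagram ?R \<subseteq> diagram (C ! Suc i)"
    using filling_iter_le_weak_chain[OF C, of P 0 i] C i eq by (simp add: weak_chains_def)
  then have "diagram ((filling ^^ (?k - Suc i)) ?R) \<subseteq> diagram (C ! (Suc i + (?k - Suc i)))"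
    by (rule filling_iter_le_weak_chain[OF C]) (use i in simp)
  also have "\<dots> = {}" using C i by (simp add: weak_chains_def)
  finally have "diagram ((filling ^^ (?k - Suc i + i)) P) = {}" by (simp add: funpow_add)
  from degree_le[OF this] show False using i by simp
qed

lemma increasing_shifted_tableaux_path_shape:
  "increasing_shifted_tableaux (path_shape P) =
     {T \<in> diagram P \<rightarrow>\<^sub>E {1..}. \<forall>c \<in> diagram P. \<forall>c' \<in> diagram P. before c c' \<longrightarrow> T c < T c'}"
proof -
  have "(\<forall>i j j'. (i, j) \<in> A \<and> (i, j') \<in> A \<and> j < j' \<longrightarrow> T (i, j) < T (i, j')) \<and>
      (\<forall>i i' j. (i, j) \<in> A \<and> (i', j) \<in> A \<and> i < i' \<longrightarrow> T (i, j) < T (i', j)) \<longleftrightarrow>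
      (\<forall>c \<in> A. \<forall>c' \<in> A. before c c' \<longrightarrow> T c < T c')"
    (is "?L \<longleftrightarrow> ?R") for A and T :: "nat \<times> nat \<Rightarrow> nat"
  proof
    assume ?L
    then show ?R by (auto simp: before_def)
  next
    assume R: ?R
    have "T c < T c'" if "c \<in> A" "c' \<in> A" "before c c'" for c c'
      using R that by blast
    then show ?L by (auto simp: before_def)
  qed
  then show ?thesis
    by (simp add: increasing_shifted_tableaux_def shifted_diagram_path_shape)
qed

definition bounded_tableaux :: "path \<Rightarrow> nat \<Rightarrow> (nat \<times> nat \<Rightarrow> nat) set" where
  "bounded_tableaux P k =
     {T \<in> increasing_shifted_tableaux (path_shape P). \<forall>c \<in> diagram P. T c \<le> k}"

text \<open>Reading the chain backwards, from the empty diagram to that of \<open>P\<close>, each cell is labelled by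
  the time at which it appears.\<close>

definition tableau_of :: "path \<Rightarrow> nat \<Rightarrow> path list \<Rightarrow> nat \<times> nat \<Rightarrow> nat" where
  "tableau_of P k C = (\<lambda>c \<in> diagram P. LEAST s. c \<in> diagram (C ! (k - s)))"

lemma tableau_of_le_iff:
  assumes C: "C \<in> weak_chains P k" and c: "c \<in> diagram P"
  shows "tableau_of P k C c \<le> s \<longleftrightarrow> c \<in> diagram (C ! (k - s))"
proof
  let ?l = "LEAST s. c \<in> diagram (C ! (k - s))"
  have "c \<in> diagram (C ! (k - k))" using C c by (simp add: weak_chains_def)
  then have l: "c \<in> diagram (C ! (k - ?l))" by (rule LeastI)
  assume "tableau_of P k C c \<le> s"
  then have "diagram (C ! (k - ?l)) \<subseteq> diagram (C ! (k - s))"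
    using c by (intro weak_chain_antimono[OF C]) (auto simp: tableau_of_def)
  with l show "c \<in> diagram (C ! (k - s))" by blast
next
  assume "c \<in> diagram (C ! (k - s))"
  then show "tableau_of P k C c \<le> s" using c by (simp add: tableau_of_def Least_le)
qed

lemma tableau_of_in_bounded:
  assumes C: "C \<in> weak_chains P k"
  shows "tableau_of P k C \<in> bounded_tableaux P k"
proof -
  let ?T = "tableau_of P k C"
  have Ck: "diagram (C ! k) = {}" "C ! 0 = P" using C by (auto simp: weak_chains_def)
  have pos: "1 \<le> ?T c" if "c \<in> diagram P" for c
    using tableau_of_le_iff[OF C that, of 0] Ck by simp
  have le: "?T c \<le> k" if "c \<in> diagram P" for c
    using tableau_of_le_iff[OF C that, of k] Ck that by simp
  have less: "?T c < ?T c'" if c: "c \<in> diagram P" and c': "c' \<in> diagram P" and "before c c'" for c c'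
  proof -
    let ?s = "?T c' - 1"
    have Suc_s: "Suc (k - ?T c') = k - ?s" "k - ?T c' < k"
      using pos[OF c'] le[OF c'] by auto
    have "c' \<in> diagram (C ! (k - ?T c'))" using tableau_of_le_iff[OF C c'] by blast
    then have "c \<in> inner (diagram (C ! (k - ?T c')))"
      using c \<open>before c c'\<close> by (auto simp: inner_def diagram_def)
    also have "\<dots> \<subseteq> diagram (C ! Suc (k - ?T c'))"
      using C Suc_s(2) by (simp add: weak_chains_def small_step_iff)
    finally have "?T c \<le> ?s" using tableau_of_le_iff[OF C c] Suc_s(1) by simp
    then show ?thesis using pos[OF c'] by simp
  qed
  have "?T \<in> diagram P \<rightarrow>\<^sub>E {1..}"
    using pos by (auto simp: PiE_def tableau_of_def)
  then show ?thesis
    using le less by (simp add: bounded_tableaux_def increasing_shifted_tableaux_path_shape)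
qed

lemma tableau_of_inj: "inj_on (tableau_of P k) (weak_chains P k)"
proof (rule inj_onI)
  fix C C' assume C: "C \<in> weak_chains P k" and C': "C' \<in> weak_chains P k"
    and eq: "tableau_of P k C = tableau_of P k C'"
  show "C = C'"
  proof (rule nth_equalityI)
    show "length C = length C'" using C C' by (simp add: weak_chains_def)
    fix s assume "s < length C"
    then have s: "s \<le> k" using C by (simp add: weak_chains_def)
    have sub: "diagram (C ! s) \<subseteq> diagram P" "diagram (C' ! s) \<subseteq> diagram P"
      using weak_chain_antimono[OF C, of 0 s] weak_chain_antimono[OF C', of 0 s] s C C'
      by (auto simp: weak_chains_def)
    have "c \<in> diagram (C ! s) \<longleftrightarrow> c \<in> diagram (C' ! s)" if "c \<in> diagram P" for c
      using tableau_of_le_iff[OF C that, of "k - s"] tableau_of_le_iff[OF C' that, of "k - s"] s eq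
      by simp
    then have "diagram (C ! s) = diagram (C' ! s)" using sub by blast
    then show "C ! s = C' ! s"
      using weak_chain_length[OF C s] weak_chain_length[OF C' s] by (intro diagram_inj) auto
  qed
qed

text \<open>The sublevel sets of \<open>T\<close> are closed under moving left and up, so they are the diagrams of
  paths, and strict increase of \<open>T\<close> makes consecutive ones differ by corners only.\<close>

lemma tableau_of_surj:
  assumes T: "T \<in> bounded_tableaux P k"
  obtains C where "C \<in> weak_chains P k" and "tableau_of P k C = T"
proof -
  have TE: "T \<in> diagram P \<rightarrow>\<^sub>E {1..}" and le: "\<And>c. c \<in> diagram P \<Longrightarrow> T c \<le> k"
    and less: "\<And>c c'. c \<in> diagram P \<Longrightarrow> c' \<in> diagram P \<Longrightarrow> before c c' \<Longrightarrow> T c < T c'"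
    using T by (auto simp: bounded_tableaux_def increasing_shifted_tableaux_path_shape)
  define L where "L s = {c \<in> diagram P. T c \<le> s}" for s
  have inner_L: "inner (L (Suc s)) \<subseteq> L s" for s
  proof
    fix c assume c: "c \<in> inner (L (Suc s))"
    then obtain c' where c': "c' \<in> diagram P" "T c' \<le> Suc s" "before c c'"
      by (auto simp: inner_def L_def)
    have "c \<in> inner (diagram P)" using c inner_mono[of "L (Suc s)" "diagram P"] by (auto simp: L_def)
    then have "c \<in> diagram P" using inner_diagram_subset by blast
    with less[OF this c'(1,3)] c'(2) show "c \<in> L s" by (simp add: L_def)
  qed
  have L_mono: "L s \<subseteq> L (Suc s)" for s by (auto simp: L_def)
  have "\<exists>Q. length Q = length P \<and> diagram Q = L s" for s
    using closed_set_is_diagram[of "L s" P] inner_L[of s] inner_mono[OF L_mono[of s]]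
    by (force simp: L_def)
  then obtain E where E: "\<And>s. length (E s) = length P" "\<And>s. diagram (E s) = L s" by metis
  define C where "C = map (\<lambda>s. E (k - s)) [0..<Suc k]"
  have C_nth: "C ! s = E (k - s)" if "s \<le> k" for s
    unfolding C_def using that by (subst nth_map) (auto simp del: upt_Suc)
  have "E k = P" using E le by (intro diagram_inj) (auto simp: L_def)
  moreover have "L 0 = {}" using TE by (force simp: L_def)
  then have "E 0 = top_path (length P)" using E by (intro diagram_inj) auto
  moreover have "small_step (E (k - i)) (E (k - Suc i))" if "i < k" for i
    using that inner_L[of "k - Suc i"] L_mono[of "k - Suc i"] E
    by (simp add: small_step_iff Suc_diff_Suc)
  ultimately have C: "C \<in> weak_chains P k"
    by (auto simp: weak_chains_def C_nth) (simp add: C_def)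
  have "tableau_of P k C c = T c" for c
  proof (cases "c \<in> diagram P")
    case True
    have "tableau_of P k C c \<le> s \<longleftrightarrow> T c \<le> s" if "s \<le> k" for s
      using tableau_of_le_iff[OF C True, of s] C_nth[of "k - s"] E(2)[of s] that True
      by (simp add: L_def)
    moreover have "tableau_of P k C c \<le> k"
      using tableau_of_in_bounded[OF C] True by (simp add: bounded_tableaux_def)
    ultimately show ?thesis using le[OF True] by (meson antisym order_refl)
  next
    case False
    then show ?thesis using PiE_arb[OF TE False] by (simp add: tableau_of_def)
  qed
  then have "tableau_of P k C = T" by auto
  with C show thesis by (rule that)
qed

lemma bij_betw_tableau_of:
  "bij_betw (tableau_of P k) (weak_chains P k) (bounded_tableaux P k)"
  unfolding bij_betw_def
  using tableau_of_inj tableau_of_in_bounded tableau_of_surj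
  by (metis (no_types, lifting) image_eqI image_subsetI subsetI subset_antisym)

section \<open>Chains of minimum length\<close>

text \<open>The least number defining the degree exists because some weak chain exists, and the iterated
  fillings reach the top no later than that chain does. Such a chain comes from the tableau whose
  entry at \<open>(i, j)\<close> is \<open>i + j - 1\<close>.\<close>

lemma filling_iter_degree: "(filling ^^ degree P) P = top_path (length P)"
proof -
  define T where "T = (\<lambda>(i, j) \<in> diagram P. i + j - 1)"
  define k where "k = Max (insert 0 (T ` diagram P))"
  have "T \<in> bounded_tableaux P k"
    unfolding bounded_tableaux_def increasing_shifted_tableaux_path_shape
  proof (intro CollectI conjI ballI impI)
    show "T \<in> diagram P \<rightarrow>\<^sub>E {1..}" by (auto simp: T_def diagram_def)
    show "T c < T c'" if "c \<in> diagram P" "c' \<in> diagram P" "before c c'" for c c'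
      using that by (auto simp: T_def diagram_def before_def)
    show "T c \<le> k" if "c \<in> diagram P" for c
      using that finite_diagram[of P] by (simp add: k_def)
  qed
  then obtain C where C: "C \<in> weak_chains P k" by (rule tableau_of_surj)
  have "diagram ((filling ^^ k) P) = {}"
    using filling_iter_le_weak_chain[OF C, of P 0 k] C by (simp add: weak_chains_def)
  then have "(filling ^^ k) P = top_path (length P)"
    by (intro diagram_inj) auto
  then show ?thesis unfolding degree_def by (rule LeastI)
qed

lemma filling_chain_in_weak_chains:
  "map (\<lambda>s. (filling ^^ s) P) [0..<Suc (degree P)] \<in> weak_chains P (degree P)"
  by (auto simp: weak_chains_def filling_iter_degree small_step_filling nth_append
      simp del: upt_Suc)

lemma small_step_path_less:
  assumes "small_step Q Q'" "Q \<noteq> Q'"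
  shows "path_less Q Q'"
proof -
  have len: "length Q' = length Q" and "diagram Q' \<subseteq> diagram Q"
    using assms(1) by (auto simp: small_step_iff)
  then have "downs Q' t \<le> downs Q t" if "t \<le> length Q" for t
    using that diagram_subset_iff[OF len] by simp
  then show ?thesis
    using assms(2) len by (auto simp: path_less_def path_le_def height_eq_downs)
qed

lemma small_interval_chains_iff:
  "C \<in> small_interval_chains P \<longleftrightarrow>
     C \<in> weak_chains P (chain_length C) \<and> (\<forall>i < chain_length C. C ! i \<noteq> C ! Suc i)"
proof (cases "C = []")
  case False
  then have len: "length C = Suc (chain_length C)" by (simp add: chain_length_def)
  have "path_less Q Q' \<and> (\<exists>S \<subseteq> valleys Q. Q' = turn_valleys S Q)
      \<longleftrightarrow> small_step Q Q' \<and> Q \<noteq> Q'" for Q Q'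
    using small_step_path_less[of Q Q'] by (auto simp: small_step_def path_less_def)
  then show ?thesis
    using False len
    by (auto simp: small_interval_chains_def weak_chains_def hd_conv_nth last_conv_nth)
qed (simp add: small_interval_chains_def weak_chains_def)

lemma min_chains_eq_weak_chains:
  "{C \<in> small_interval_chains P.
     \<forall>C' \<in> small_interval_chains P. chain_length C \<le> chain_length C'} = weak_chains P (degree P)"
    (is "?M = _")
proof -
  have W: "C \<in> small_interval_chains P \<and> chain_length C = degree P"
    if "C \<in> weak_chains P (degree P)" for C
  proof -
    have "chain_length C = degree P" using that by (simp add: weak_chains_def chain_length_def)
    then show ?thesis
      using that weak_chain_degree_strict[OF that] by (simp add: small_interval_chains_iff)
  qed
  have ge: "degree P \<le> chain_length C" if "C \<in> small_interval_chains P" for C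
    using that degree_le_weak_chain by (auto simp: small_interval_chains_iff)
  show ?thesis
  proof
    show "?M \<subseteq> weak_chains P (degree P)"
    proof
      fix C assume C: "C \<in> ?M"
      then have "chain_length C \<le> degree P"
        using W[OF filling_chain_in_weak_chains[of P]] by force
      with C ge[of C] have "chain_length C = degree P" by auto
      with C show "C \<in> weak_chains P (degree P)" by (simp add: small_interval_chains_iff)
    qed
    show "weak_chains P (degree P) \<subseteq> ?M" using W ge by auto
  qed
qed

text \<open>A tableau with maximum \<open>m\<close> comes from a weak chain of length \<open>m\<close>, whence \<open>degree P \<le> m\<close>.
  The diagram has to be nonempty for the maximum entry to be meaningful.\<close>

lemma bounded_tableaux_degree:
  assumes ne: "diagram P \<noteq> {}"
  shows "bounded_tableaux P (degree P) =
    {T \<in> increasing_shifted_tableaux (path_shape P). max_entry (path_shape P) T = degree P}"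
proof -
  have "(\<forall>c \<in> diagram P. T c \<le> degree P) \<longleftrightarrow> max_entry (path_shape P) T = degree P"
    if T: "T \<in> increasing_shifted_tableaux (path_shape P)" for T
  proof -
    let ?m = "max_entry (path_shape P) T"
    have m: "?m \<le> k \<longleftrightarrow> (\<forall>c \<in> diagram P. T c \<le> k)" for k
      using ne finite_diagram[of P] by (simp add: max_entry_def shifted_diagram_path_shape)
    then have "T \<in> bounded_tableaux P ?m" using T by (auto simp: bounded_tableaux_def)
    then obtain C where "C \<in> weak_chains P ?m" by (rule tableau_of_surj)
    then have "degree P \<le> ?m" by (rule degree_le_weak_chain)
    then show ?thesis using m[of "degree P"] by auto
  qed
  then show ?thesis by (auto simp: bounded_tableaux_def)
qed

theorem corollary7:
  fixes n :: nat and P :: path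
  assumes "P \<in> paths n"
    and "P \<noteq> []" and "hd P = D"
  shows "num_min_chains P =
    card {T \<in> increasing_shifted_tableaux (path_shape P). max_entry (path_shape P) T = degree P}"
proof -
  have "downs P 1 = 1" using assms(2,3) by (cases P) (simp_all add: downs_def)
  then have "(1, length P) \<in> diagram P" using assms(2) by (cases P) (simp_all add: diagram_def)
  then have "diagram P \<noteq> {}" by blast
  then show ?thesis
    using bij_betw_same_card[OF bij_betw_tableau_of[of P "degree P"]]
    by (simp add: num_min_chains_def min_chains_eq_weak_chains bounded_tableaux_degree)
qed

end
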